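(* Let $G$ be a finite graph with at least one vertex and maximum degree $\Delta$, and let $\tau$ be a threshold assignment for $G$. Let $\bar{t}=\sum_{v\in V(G)}\tau(v)/|G|$ be the average threshold and $t_M=\max_{v\in V(G)}\tau(v)$ the maximum threshold, and assume $\bar t>0$. Then every $\tau$-dynamic monopoly $M$ of $G$ satisfies $$|M|\geq |G|\Big(1-\frac{\epsilon(G)}{\bar{t}}\Big)\Big(\frac{\bar{t}}{t_M}\Big) \geq |G|\Big(1-\frac{\epsilon(G)}{\bar{t}}\Big)\Big(\frac{\bar{t}}{\Delta}\Big),$$ where $\epsilon(G)=|E(G)|/|G|$.
   Context: Graphs are finite, undirected, without loops or multiple edges. A threshold assignment for $G$ is a function $\tau:V(G)\to\mathbb{N}\cup\{0\}$ with $\tau(v)\le \deg(v)$ for every vertex $v$. For $M\subseteq V(G)$, the $\tau$-dynamic process starting from $M$ is the sequence $D_0=M$ and, for $i\ge 0$, $D_{i+1}$ = set of vertices $v\notin D_0\cup\dots\cup D_i$ having at least $\tau(v)$ neighbours in $D_0\cup\dots\cup D_i$. The set $M$ is a $\tau$-dynamic monopoly (dynamo) if $\bigcup_i D_i=V(G)$. The edge density is $\epsilon(G)=|E(G)|/|G|$.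
   Formalization: The second inequality, between the t_M-bound and the Δ-bound, is asserted only when ε(G) ≤ t̄, since it fails when ε(G) > t̄ and t_M < Δ; both bounds are still proved as lower bounds for |M| without that condition. *)

theory Defs
  imports Complex_Main
begin

definition simple_graph :: "'a set \<Rightarrow> 'a set set \<Rightarrow> bool" where
  "simple_graph V E \<longleftrightarrow> finite V \<and> (\<forall>e\<in>E. e \<subseteq> V \<and> card e = 2)"

definition neighbours :: "'a set set \<Rightarrow> 'a \<Rightarrow> 'a set" where
  "neighbours E v = {u. {u, v} \<in> E}"

definition vertex_degree :: "'a set set \<Rightarrow> 'a \<Rightarrow> nat" where
  "vertex_degree E v = card (neighbours E v)"

definition max_degree :: "'a set \<Rightarrow> 'a set set \<Rightarrow> nat" where
  "max_degree V E = Max (vertex_degree E ` V)"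

definition edge_density :: "'a set \<Rightarrow> 'a set set \<Rightarrow> real" where
  "edge_density V E = real (card E) / real (card V)"

definition threshold_assignment :: "'a set \<Rightarrow> 'a set set \<Rightarrow> ('a \<Rightarrow> nat) \<Rightarrow> bool" where
  "threshold_assignment V E \<tau> \<longleftrightarrow> (\<forall>v\<in>V. \<tau> v \<le> vertex_degree E v)"

definition avg_threshold :: "'a set \<Rightarrow> ('a \<Rightarrow> nat) \<Rightarrow> real" where
  "avg_threshold V \<tau> = (\<Sum>v\<in>V. real (\<tau> v)) / real (card V)"

definition max_threshold :: "'a set \<Rightarrow> ('a \<Rightarrow> nat) \<Rightarrow> nat" where
  "max_threshold V \<tau> = Max (\<tau> ` V)"

fun dynamic_process ::
    "'a set \<Rightarrow> 'a set set \<Rightarrow> ('a \<Rightarrow> nat) \<Rightarrow> 'a set \<Rightarrow> nat \<Rightarrow> 'a set" where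
  "dynamic_process V E \<tau> M 0 = M"
| "dynamic_process V E \<tau> M (Suc i) =
     {v \<in> V. v \<notin> (\<Union>j\<in>{..i}. dynamic_process V E \<tau> M j) \<and>
        \<tau> v \<le> card (neighbours E v \<inter> (\<Union>j\<in>{..i}. dynamic_process V E \<tau> M j))}"

definition dynamo :: "'a set \<Rightarrow> 'a set set \<Rightarrow> ('a \<Rightarrow> nat) \<Rightarrow> 'a set \<Rightarrow> bool" where
  "dynamo V E \<tau> M \<longleftrightarrow> M \<subseteq> V \<and> (\<Union>i. dynamic_process V E \<tau> M i) = V"

end

theory Submission
  imports Defs
begin

text \<open>
  Orient every edge towards the endpoint that is activated later. A vertex outside \<open>M\<close> is
  entered by at least \<open>\<tau> v\<close> edges and no edge is counted twice, so the thresholds outside \<open>M\<close>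
  sum to at most \<open>|E|\<close>. Those inside \<open>M\<close> sum to at most \<open>t\<^sub>M |M|\<close>. The stated bound is
  \<open>(\<Sum>\<tau> - |E|) / t\<^sub>M\<close> in disguise.
\<close>

text \<open>The process is abstracted to a rank \<open>f\<close>: an edge is charged to its endpoint
  of larger rank, and an edge between equal ranks to neither.\<close>

lemma sum_le_card_edges_of_rank:
  fixes f :: "'a \<Rightarrow> nat"
  assumes "finite E" "finite A"
    and le: "\<And>v. v \<in> A \<Longrightarrow> \<tau> v \<le> card {u \<in> neighbours E v. f u < f v}"
  shows "sum \<tau> A \<le> card E"
proof -
  let ?P = "\<lambda>v. (\<lambda>u. {u, v}) ` {u \<in> neighbours E v. f u < f v}"
  have sub: "?P v \<subseteq> E" for v
    by (auto simp: neighbours_def)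
  have "sum \<tau> A \<le> (\<Sum>v\<in>A. card (?P v))"
  proof (rule sum_mono)
    fix v assume "v \<in> A"
    have "inj_on (\<lambda>u. {u, v}) {u \<in> neighbours E v. f u < f v}"
      by (auto simp: inj_on_def doubleton_eq_iff)
    then show "\<tau> v \<le> card (?P v)"
      using le[OF \<open>v \<in> A\<close>] by (simp add: card_image)
  qed
  also have "\<dots> = card (\<Union>v\<in>A. ?P v)"
  proof (rule card_UN_disjoint[symmetric])
    show "finite A" by fact
    show "\<forall>v\<in>A. finite (?P v)"
      using sub \<open>finite E\<close> finite_subset by blast
    \<comment> \<open>A common edge of \<open>?P v\<close> and \<open>?P w\<close> would be
      \<open>{v, w}\<close>, forcing both \<open>f w < f v\<close> and
      \<open>f v < f w\<close>.\<close>
    show "\<forall>v\<in>A. \<forall>w\<in>A. v \<noteq> w \<longrightarrow> ?P v \<inter> ?P w = {}"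
      by (auto simp: doubleton_eq_iff)
  qed
  also have "\<dots> \<le> card E"
    using sub by (intro card_mono \<open>finite E\<close>) blast
  finally show ?thesis .
qed

lemma simple_graph_finite_edges: "simple_graph V E \<Longrightarrow> finite E"
  unfolding simple_graph_def by (meson Pow_iff finite_Pow_iff finite_subset subsetI)

lemma simple_graph_finite_neighbours:
  assumes "simple_graph V E"
  shows "finite (neighbours E v)"
proof (rule finite_subset)
  show "neighbours E v \<subseteq> V"
    using assms by (auto simp: simple_graph_def neighbours_def)
  show "finite V"
    using assms by (simp add: simple_graph_def)
qed

lemma dynamo_sum_threshold_outside_le:
  assumes G: "simple_graph V E" and dyn: "dynamo V E \<tau> M"
  shows "sum \<tau> (V - M) \<le> card E"
proof (rule sum_le_card_edges_of_rank)
  let ?D = "dynamic_process V E \<tau> M"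
  \<comment> \<open>The activation round serves as the rank. Taking \<open>LEAST\<close> avoids
    having to show that the rounds are pairwise disjoint.\<close>
  define f where "f v = (LEAST i. v \<in> ?D i)" for v
  show "finite E" using G by (rule simple_graph_finite_edges)
  show "finite (V - M)" using G by (simp add: simple_graph_def)
  fix v assume v: "v \<in> V - M"
  then obtain i where "v \<in> ?D i"
    using dyn by (auto simp: dynamo_def)
  then have inD: "v \<in> ?D (f v)"
    unfolding f_def by (rule LeastI)
  \<comment> \<open>Round 0 is \<open>M\<close>, which does not contain \<open>v\<close>; so the
    recursive clause of the process applies at \<open>f v\<close>.\<close>
  with v obtain k where k: "f v = Suc k"
    by (cases "f v") auto
  have "\<tau> v \<le> card (neighbours E v \<inter> (\<Union>j\<in>{..k}. ?D j))"
    using inD unfolding k by simp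
  also have "\<dots> \<le> card {u \<in> neighbours E v. f u < f v}"
  proof (rule card_mono)
    show "finite {u \<in> neighbours E v. f u < f v}"
      using simple_graph_finite_neighbours[OF G] by simp
    \<comment> \<open>A neighbour active by round \<open>k\<close> thus has rank at most
      \<open>k\<close>, strictly below \<open>f v = Suc k\<close>.\<close>
    have "f u \<le> j" if "u \<in> ?D j" for u j
      unfolding f_def using that by (rule Least_le)
    then show "neighbours E v \<inter> (\<Union>j\<in>{..k}. ?D j) \<subseteq> {u \<in> neighbours E v. f u < f v}"
      unfolding k by (auto simp: less_Suc_eq_le intro: order_trans)
  qed
  finally show "\<tau> v \<le> card {u \<in> neighbours E v. f u < f v}" .
qed

lemma threshold_le_max_threshold:
  assumes "finite V" "v \<in> V"
  shows "\<tau> v \<le> max_threshold V \<tau>"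
  using assms by (simp add: max_threshold_def)

lemma dynamo_sum_threshold_le:
  assumes G: "simple_graph V E" and dyn: "dynamo V E \<tau> M"
  shows "sum \<tau> V \<le> card E + max_threshold V \<tau> * card M"
proof -
  have fin: "finite V" and MV: "M \<subseteq> V"
    using G dyn by (auto simp: simple_graph_def dynamo_def)
  have "sum \<tau> M \<le> max_threshold V \<tau> * card M"
    using sum_bounded_above[of M \<tau> "max_threshold V \<tau>"] threshold_le_max_threshold[OF fin] MV
    by (simp add: subset_iff mult.commute)
  then show ?thesis
    using dynamo_sum_threshold_outside_le[OF G dyn] sum.subset_diff[OF MV fin, of \<tau>]
    by linarith
qed

lemma max_threshold_le_max_degree:
  assumes "finite V" "V \<noteq> {}" "threshold_assignment V E \<tau>"
  shows "max_threshold V \<tau> \<le> max_degree V E"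
  unfolding max_threshold_def max_degree_def
  using assms by (subst Max_le_iff) (auto simp: threshold_assignment_def Max_ge_iff)

text \<open>The comparison of the two bounds is conditional: if \<open>card E\<close> exceeds the
  threshold sum, the common numerator is negative and a larger denominator raises the quotient. The
  bound with the maximum degree still holds then, its right-hand side being at most 0.\<close>

theorem theorem1:
  fixes V :: "'a set" and E :: "'a set set" and \<tau> :: "'a \<Rightarrow> nat" and M :: "'a set"
  assumes "simple_graph V E"
    and "V \<noteq> {}"
    and "threshold_assignment V E \<tau>"
    and "avg_threshold V \<tau> > 0"
    and "dynamo V E \<tau> M"
  shows "real (card M) \<ge>
           real (card V) * (1 - edge_density V E / avg_threshold V \<tau>) *
             (avg_threshold V \<tau> / real (max_threshold V \<tau>))
       \<and> (edge_density V E \<le> avg_threshold V \<tau> \<longrightarrow>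
           real (card V) * (1 - edge_density V E / avg_threshold V \<tau>) *
             (avg_threshold V \<tau> / real (max_threshold V \<tau>))
           \<ge> real (card V) * (1 - edge_density V E / avg_threshold V \<tau>) *
             (avg_threshold V \<tau> / real (max_degree V E)))
       \<and> real (card M) \<ge>
           real (card V) * (1 - edge_density V E / avg_threshold V \<tau>) *
             (avg_threshold V \<tau> / real (max_degree V E))"
proof -
  let ?S = "real (sum \<tau> V)" and ?m = "real (card E)"
  let ?t = "real (max_threshold V \<tau>)" and ?\<Delta> = "real (max_degree V E)"
  have fin: "finite V" using assms(1) by (simp add: simple_graph_def)
  have n: "real (card V) > 0"
    using fin assms(2) by (simp add: card_gt_0_iff)
  have S: "?S > 0"
    using assms(4) n by (simp add: avg_threshold_def zero_less_divide_iff)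
  \<comment> \<open>Both bounds are instances of this identity, with \<open>d\<close> the maximum
    threshold or the maximum degree. It also holds for \<open>d = 0\<close>, where both sides are
    0.\<close>
  have eq: "real (card V) * (1 - edge_density V E / avg_threshold V \<tau>) * (avg_threshold V \<tau> / d)
      = (?S - ?m) / d" for d
    using n S by (simp add: edge_density_def avg_threshold_def diff_divide_distrib algebra_simps)
  have dens: "edge_density V E \<le> avg_threshold V \<tau> \<longleftrightarrow> ?m \<le> ?S"
    using n by (simp add: edge_density_def avg_threshold_def divide_le_cancel)
  \<comment> \<open>A positive threshold sum has a positive term, so the maximum threshold, and with
    it the maximum degree, is a positive divisor.\<close>
  obtain v where "v \<in> V" "\<tau> v > 0"
    using S by (metis gr_zeroI of_nat_0 less_irrefl sum.neutral)
  then have t: "?t > 0"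
    using threshold_le_max_threshold[OF fin, of v \<tau>] by simp
  have t\<Delta>: "?t \<le> ?\<Delta>"
    using max_threshold_le_max_degree[OF fin assms(2,3)] by simp
  have "?S \<le> ?m + ?t * real (card M)"
    using dynamo_sum_threshold_le[OF assms(1,5)] by (metis of_nat_add of_nat_le_iff of_nat_mult)
  then have 1: "(?S - ?m) / ?t \<le> real (card M)"
    using t by (simp add: divide_le_eq algebra_simps)
  have 2: "(?S - ?m) / ?\<Delta> \<le> (?S - ?m) / ?t" if "?m \<le> ?S"
    using that t t\<Delta> by (intro divide_left_mono) auto
  have 3: "(?S - ?m) / ?\<Delta> \<le> real (card M)"
  proof (cases "?m \<le> ?S")
    case True
    then show ?thesis using 1 2 by linarith
  next
    case False
    then have "(?S - ?m) / ?\<Delta> \<le> 0"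
      by (intro divide_nonpos_nonneg) auto
    then show ?thesis using of_nat_0_le_iff[of "card M"] by linarith
  qed
  show ?thesis
    unfolding eq dens using 1 2 3 by blast
qed

end
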